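(* Let $\Delta \ge 3$ be an integer and let $\boldsymbol\theta = (\theta_0,\ldots,\theta_\Delta)$ be a strictly positive vector which is log-convex. Then for all $\lambda > 0$, the family of potentials $(\lambda,\boldsymbol\theta)$ satisfies the FKG Inequality on $T_\infty$ under the partial order $\tilde\le$; that is, for all $d \ge 0$, all $\omega^1,\omega^2 \in \Omega_{T_d}$, and all $\eta \in \tilde\Omega_{\partial T_d}$, $$\mathbb{P}_{\lambda,\boldsymbol\theta}(T_d = \omega^1 \wedge \omega^2 \mid \eta)\,\mathbb{P}_{\lambda,\boldsymbol\theta}(T_d = \omega^1 \vee \omega^2 \mid \eta) \;\ge\; \mathbb{P}_{\lambda,\boldsymbol\theta}(T_d = \omega^1 \mid \eta)\,\mathbb{P}_{\lambda,\boldsymbol\theta}(T_d = \omega^2 \mid \eta).$$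
   Context: Log-convexity: a strictly positive sequence $(x_0,\ldots,x_n)$ is log-convex if $x_{i+1}/x_i \ge x_i/x_{i-1}$ for all $i \in \{1,\ldots,n-1\}$. Model. $T_\infty$ is the infinite $\Delta$-regular tree, rooted at a node $0$, with graph distance $d(\cdot,\cdot)$; $T_\infty$ also denotes its node set. For $S \subseteq T_\infty$, $\Omega_S = \{0,1\}^S$; for $\omega\in\Omega_S$ write $\omega_{\{i\}}$ for the spin at $i$, $\omega_{S'}$ for the restriction to $S'\subseteq S$, and $|\omega| = \sum_{i\in S}\omega_{\{i\}}$. $\tilde\Omega_S \subseteq \Omega_S$ is the set of $\omega$ with no two adjacent nodes of $S$ both having spin $1$. For disjoint $S_1,S_2$ and $\omega^1\in\Omega_{S_1}$, $\omega^2\in\Omega_{S_2}$, $\omega^1\cdot\omega^2\in\Omega_{S_1\cup S_2}$ is the combined configuration. $T_d$ is the set of nodes at distance at most $d$ from $0$, and $\partial S$ is the set of nodes not in $S$ at distance at most $2$ from $S$. For a node $i$, $N(i)$ is the set consisting of $i$ and its $\Delta$ neighbors. For $\lambda>0$ and strictly positive $\boldsymbol\theta$, define for each node $i$ and $\omega\in\Omega_{N(i)}$ the potential $$\Phi_{N(i)}(\omega) = \begin{cases} -\log\lambda & \text{if } \omega_{\{i\}}=1,\ |\omega_{N(i)}|=1,\\ -\log\theta_k & \text{if } \omega_{\{i\}}=0,\ |\omega_{N(i)}|=k,\\ \infty & \text{otherwise.}\end{cases}$$ All other potentials are zero. This family of potentials is denoted $(\lambda,\boldsymbol\theta)$. For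 finite $\Lambda\subseteq T_\infty$ and $\omega\in\Omega_{\Lambda\cup\partial\Lambda}$, the Hamiltonian is $\mathcal{H}_\Lambda(\omega) = \sum_{i:\,N(i)\cap\Lambda\ne\emptyset}\Phi_{N(i)}(\omega_{N(i)})$. For $\omega\in\Omega_{T_d}$ and $\eta\in\tilde\Omega_{\partial T_d}$, $$\mathbb{P}_{\lambda,\boldsymbol\theta}(T_d=\omega\mid\eta) = \frac{\exp(-\mathcal{H}_{T_d}(\omega\cdot\eta))}{\sum_{\nu\in\Omega_{T_d}}\exp(-\mathcal{H}_{T_d}(\nu\cdot\eta))},\qquad \exp(-\infty)=0.$$ Partial order. $T^e_\infty$ is the set of nodes at even distance from $0$ (including $0$), and $T^o_\infty = T_\infty\setminus T^e_\infty$. For $\omega^1,\omega^2\in\Omega_S$, $\omega^1\,\tilde\le\,\omega^2$ means $\omega^1_{\{i\}}\le\omega^2_{\{i\}}$ for $i\in S\cap T^e_\infty$ and $\omega^1_{\{i\}}\ge\omega^2_{\{i\}}$ for $i\in S\cap T^o_\infty$. Meet: $(\omega^1\wedge\omega^2)_{\{i\}}$ equals $\min(\omega^1_{\{i\}},\omega^2_{\{i\}})$ for $i\in S\cap T^e_\infty$ and $\max(\omega^1_{\{i\}},\omega^2_{\{i\}})$ for $i\in S\cap T^o_\infty$. Join: $(\omega^1\vee\omega^2)_{\{i\}}$ equals $\max(\omega^1_{\{i\}},\omega^2_{\{i\}})$ for $i\in S\cap T^e_\infty$ and $\min(\omega^1_{\{i\}},\omega^2_{\{i\}})$ for $i\in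 S\cap T^o_\infty$. *)

theory Defs
  imports Complex_Main "HOL-Library.FuncSet" "HOL-Library.Extended_Real"
begin

definition log_convex :: "nat \<Rightarrow> (nat \<Rightarrow> real) \<Rightarrow> bool" where
  "log_convex n x \<longleftrightarrow> (\<forall>i\<in>{1..n-1}. x (i + 1) / x i \<ge> x i / x (i - 1))"

(* The type 'v is the node set of the tree and E its symmetric adjacency relation.
   Cycles have at least 3 nodes; the tree predicate of Graph_Theory is unsuitable here because
   it counts the two orientations of a single edge as a cycle. For \<Delta> \<ge> 2 these axioms
   force the tree to be infinite and determine it up to isomorphism. *)

definition is_cycle :: "('v \<times> 'v) set \<Rightarrow> 'v list \<Rightarrow> bool" where
  "is_cycle E vs \<longleftrightarrow> length vs \<ge> 3 \<and> distinct vs \<and>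
     successively (\<lambda>u v. (u, v) \<in> E) vs \<and> (last vs, hd vs) \<in> E"

definition regular_tree :: "nat \<Rightarrow> ('v \<times> 'v) set \<Rightarrow> bool" where
  "regular_tree \<Delta> E \<longleftrightarrow>
     sym E \<and> irrefl E \<and>
     (\<forall>u v. (u, v) \<in> E\<^sup>*) \<and>
     (\<nexists>vs. is_cycle E vs) \<and>
     (\<forall>v. finite (E `` {v}) \<and> card (E `` {v}) = \<Delta>)"

definition gdist :: "('v \<times> 'v) set \<Rightarrow> 'v \<Rightarrow> 'v \<Rightarrow> nat" where
  "gdist E u v = (LEAST n. (u, v) \<in> E ^^ n)"

definition tree_ball :: "('v \<times> 'v) set \<Rightarrow> 'v \<Rightarrow> nat \<Rightarrow> 'v set" where
  "tree_ball E r d = {v. gdist E r v \<le> d}"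

definition boundary :: "('v \<times> 'v) set \<Rightarrow> 'v set \<Rightarrow> 'v set" where
  "boundary E S = {v. v \<notin> S \<and> (\<exists>u\<in>S. gdist E u v \<le> 2)}"

definition nbhd :: "('v \<times> 'v) set \<Rightarrow> 'v \<Rightarrow> 'v set" where
  "nbhd E i = insert i (E `` {i})"

(* A configuration on S is an extensional function, so equality of configurations on S is
   equality of their spins on S. *)

definition configs :: "'v set \<Rightarrow> ('v \<Rightarrow> nat) set" where
  "configs S = S \<rightarrow>\<^sub>E {0, 1}"

definition hardcore_configs :: "('v \<times> 'v) set \<Rightarrow> 'v set \<Rightarrow> ('v \<Rightarrow> nat) set" where
  "hardcore_configs E S =
     {\<omega> \<in> configs S. \<forall>i\<in>S. \<forall>j\<in>S. (i, j) \<in> E \<longrightarrow> \<not> (\<omega> i = 1 \<and> \<omega> j = 1)}"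

definition combine :: "'v set \<Rightarrow> 'v set \<Rightarrow> ('v \<Rightarrow> nat) \<Rightarrow> ('v \<Rightarrow> nat) \<Rightarrow> 'v \<Rightarrow> nat" where
  "combine S1 S2 \<omega>1 \<omega>2 = (\<lambda>i\<in>S1 \<union> S2. if i \<in> S1 then \<omega>1 i else \<omega>2 i)"

definition potential ::
  "('v \<times> 'v) set \<Rightarrow> real \<Rightarrow> (nat \<Rightarrow> real) \<Rightarrow> 'v \<Rightarrow> ('v \<Rightarrow> nat) \<Rightarrow> ereal" where
  "potential E lam \<theta> i \<omega> =
     (let k = \<Sum>j\<in>nbhd E i. \<omega> j in
      if \<omega> i = 1 \<and> k = 1 then ereal (- ln lam)
      else if \<omega> i = 0 then ereal (- ln (\<theta> k))
      else \<infinity>)"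

definition hamiltonian ::
  "('v \<times> 'v) set \<Rightarrow> real \<Rightarrow> (nat \<Rightarrow> real) \<Rightarrow> 'v set \<Rightarrow> ('v \<Rightarrow> nat) \<Rightarrow> ereal" where
  "hamiltonian E lam \<theta> \<Lambda> \<omega> =
     (\<Sum>i | nbhd E i \<inter> \<Lambda> \<noteq> {}. potential E lam \<theta> i (restrict \<omega> (nbhd E i)))"

(* The value at \<infinity> is a dummy: potentials never equal -\<infinity>, so the argument -H below
   never equals \<infinity>. *)

definition exp_ereal :: "ereal \<Rightarrow> real" where
  "exp_ereal x = (if \<bar>x\<bar> = \<infinity> then 0 else exp (real_of_ereal x))"

definition gibbs_weight ::
  "('v \<times> 'v) set \<Rightarrow> 'v \<Rightarrow> real \<Rightarrow> (nat \<Rightarrow> real) \<Rightarrow> nat \<Rightarrow> ('v \<Rightarrow> nat) \<Rightarrow> ('v \<Rightarrow> nat) \<Rightarrow> real" where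
  "gibbs_weight E r lam \<theta> d \<eta> \<omega> =
     (let T = tree_ball E r d in
      exp_ereal (- hamiltonian E lam \<theta> T (combine T (boundary E T) \<omega> \<eta>)))"

(* gibbs_prob E r lam \<theta> d \<eta> \<omega> is P(T_d = \<omega> | \<eta>). *)

definition gibbs_prob ::
  "('v \<times> 'v) set \<Rightarrow> 'v \<Rightarrow> real \<Rightarrow> (nat \<Rightarrow> real) \<Rightarrow> nat \<Rightarrow> ('v \<Rightarrow> nat) \<Rightarrow> ('v \<Rightarrow> nat) \<Rightarrow> real" where
  "gibbs_prob E r lam \<theta> d \<eta> \<omega> =
     gibbs_weight E r lam \<theta> d \<eta> \<omega> /
     (\<Sum>\<nu>\<in>configs (tree_ball E r d). gibbs_weight E r lam \<theta> d \<eta> \<nu>)"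

definition even_nodes :: "('v \<times> 'v) set \<Rightarrow> 'v \<Rightarrow> 'v set" where
  "even_nodes E r = {v. even (gdist E r v)}"

definition config_le ::
  "('v \<times> 'v) set \<Rightarrow> 'v \<Rightarrow> 'v set \<Rightarrow> ('v \<Rightarrow> nat) \<Rightarrow> ('v \<Rightarrow> nat) \<Rightarrow> bool" where
  "config_le E r S \<omega>1 \<omega>2 \<longleftrightarrow>
     (\<forall>i\<in>S \<inter> even_nodes E r. \<omega>1 i \<le> \<omega>2 i) \<and>
     (\<forall>i\<in>S - even_nodes E r. \<omega>1 i \<ge> \<omega>2 i)"

definition config_meet ::
  "('v \<times> 'v) set \<Rightarrow> 'v \<Rightarrow> 'v set \<Rightarrow> ('v \<Rightarrow> nat) \<Rightarrow> ('v \<Rightarrow> nat) \<Rightarrow> 'v \<Rightarrow> nat" where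
  "config_meet E r S \<omega>1 \<omega>2 =
     (\<lambda>i\<in>S. if i \<in> even_nodes E r then min (\<omega>1 i) (\<omega>2 i) else max (\<omega>1 i) (\<omega>2 i))"

definition config_join ::
  "('v \<times> 'v) set \<Rightarrow> 'v \<Rightarrow> 'v set \<Rightarrow> ('v \<Rightarrow> nat) \<Rightarrow> ('v \<Rightarrow> nat) \<Rightarrow> 'v \<Rightarrow> nat" where
  "config_join E r S \<omega>1 \<omega>2 =
     (\<lambda>i\<in>S. if i \<in> even_nodes E r then max (\<omega>1 i) (\<omega>2 i) else min (\<omega>1 i) (\<omega>2 i))"

lemma config_meet_glb:
  "config_le E r S \<nu> (config_meet E r S \<omega>1 \<omega>2) \<longleftrightarrow>
     config_le E r S \<nu> \<omega>1 \<and> config_le E r S \<nu> \<omega>2"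
  unfolding config_le_def config_meet_def by auto

lemma config_join_lub:
  "config_le E r S (config_join E r S \<omega>1 \<omega>2) \<nu> \<longleftrightarrow>
     config_le E r S \<omega>1 \<nu> \<and> config_le E r S \<omega>2 \<nu>"
  unfolding config_le_def config_join_def by auto

lemma config_meet_in_configs:
  assumes "\<omega>1 \<in> configs S" "\<omega>2 \<in> configs S"
  shows "config_meet E r S \<omega>1 \<omega>2 \<in> configs S"
  using assms unfolding configs_def config_meet_def
  by (auto simp: PiE_iff min_def max_def)

lemma config_join_in_configs:
  assumes "\<omega>1 \<in> configs S" "\<omega>2 \<in> configs S"
  shows "config_join E r S \<omega>1 \<omega>2 \<in> configs S"
  using assms unfolding configs_def config_join_def
  by (auto simp: PiE_iff min_def max_def)

(* The FKG inequality for the family (lam, \<theta>) under the order config_le, whose meet and join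
   are config_meet and config_join. *)

definition satisfies_FKG :: "('v \<times> 'v) set \<Rightarrow> 'v \<Rightarrow> real \<Rightarrow> (nat \<Rightarrow> real) \<Rightarrow> bool" where
  "satisfies_FKG E r lam \<theta> \<longleftrightarrow>
     (\<forall>d. \<forall>\<omega>1 \<in> configs (tree_ball E r d). \<forall>\<omega>2 \<in> configs (tree_ball E r d).
      \<forall>\<eta> \<in> hardcore_configs E (boundary E (tree_ball E r d)).
        gibbs_prob E r lam \<theta> d \<eta> (config_meet E r (tree_ball E r d) \<omega>1 \<omega>2) *
        gibbs_prob E r lam \<theta> d \<eta> (config_join E r (tree_ball E r d) \<omega>1 \<omega>2)
        \<ge> gibbs_prob E r lam \<theta> d \<eta> \<omega>1 * gibbs_prob E r lam \<theta> d \<eta> \<omega>2)"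

end

theory Submission
  imports Defs
begin

text \<open>The Gibbs weight of a configuration is a product of local factors, one for each node \<open>i\<close>,
  and the factor of \<open>i\<close> depends only on the spin \<open>s\<close> of \<open>i\<close> and the number \<open>k\<close> of its occupied
  neighbors. Log-supermodularity, that is \<open>w \<omega>1 * w \<omega>2 \<le> w (meet \<omega>1 \<omega>2) * w (join \<omega>1 \<omega>2)\<close>, is
  preserved by products of nonnegative functions, so it is enough to prove it for a single factor;
  the normalizing constant and the boundary condition are common to all four configurations.

  A tree is bipartite: adjacent nodes lie at distances of opposite parity from the root
  (\<open>even_nodes_adjacent_iff\<close>). The order is therefore reversed between a node and its neighbors,
  so around an even node the meet takes the minimum of the two center spins and the maximum of the
  neighbors' spins, and the join does the opposite; around an odd node meet and join change places.
  In both cases one needs the same inequality (\<open>spin_weight_supermodular\<close>). If a center spin is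
  \<open>1\<close>, the hard-core constraint leaves its factor nonzero only when its neighbors are all empty,
  and the two sides then agree. If both center spins are \<open>0\<close>, the inequality reads
  \<open>\<theta> a * \<theta> b \<le> \<theta> m * \<theta> M\<close>, where \<open>m\<close> and \<open>M\<close> count the nodes occupied in both
  and in at least one of the two neighborhoods; as \<open>m \<le> a, b\<close> and \<open>m + M = a + b\<close>, it is an
  instance of log-convexity (\<open>log_convex_spread\<close>).\<close>

section \<open>Log-convex sequences\<close>

text \<open>The ratio of consecutive terms increases, so moving \<open>p\<close> steps up from \<open>b\<close> multiplies the
  sequence by at least as much as moving \<open>p\<close> steps up from a lower starting point \<open>m\<close>.\<close>

lemma log_convex_shift:
  assumes conv: "log_convex n x" and pos: "\<forall>k\<le>n. x k > 0"
    and "m \<le> b" and "b + p \<le> n"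
  shows "x (m + p) * x b \<le> x m * x (b + p)"
  using \<open>b + p \<le> n\<close>
proof (induction p)
  case 0
  then show ?case by simp
next
  case (Suc p)
  have ratio_Suc: "x (k + 1) / x k \<le> x (k + 2) / x (k + 1)" if "k + 2 \<le> n" for k
    using conv that unfolding log_convex_def by (auto dest!: bspec[where x = "k + 1"])
  have ratio_mono: "x (k + 1) / x k \<le> x (l + 1) / x l" if "k \<le> l" "l + 1 \<le> n" for k l
    using that
  proof (induction l rule: dec_induct)
    case base
    then show ?case by simp
  next
    case (step l)
    then show ?case using ratio_Suc[of l] by force
  qed
  have xpos: "x k > 0" if "k \<le> n" for k
    using pos that by blast
  have "x (m + p + 1) / x (m + p) \<le> x (b + p + 1) / x (b + p)"
    using ratio_mono[of "m + p" "b + p"] \<open>m \<le> b\<close> Suc.prems by simp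
  moreover have "x (m + p) * x b \<le> x m * x (b + p)"
    using Suc by simp
  moreover have "0 \<le> x (b + p + 1) / x (b + p)" "0 \<le> x (m + p) * x b"
    using xpos[of "b + p"] xpos[of "b + p + 1"] xpos[of "m + p"] xpos[of b] \<open>m \<le> b\<close> Suc.prems
    by simp_all
  ultimately have "(x (m + p + 1) / x (m + p)) * (x (m + p) * x b)
      \<le> (x (b + p + 1) / x (b + p)) * (x m * x (b + p))"
    by (rule mult_mono)
  moreover have "x (m + p) \<noteq> 0" "x (b + p) \<noteq> 0"
    using xpos[of "m + p"] xpos[of "b + p"] \<open>m \<le> b\<close> Suc.prems by auto
  ultimately show ?case
    by (simp add: mult.commute mult.left_commute)
qed

lemma log_convex_spread:
  assumes "log_convex n x" and "\<forall>k\<le>n. x k > 0"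
    and "m \<le> a" and "m \<le> b" and "m + M = a + b" and "M \<le> n"
  shows "x a * x b \<le> x m * x M"
proof -
  have "m + (a - m) = a" "b + (a - m) = M"
    using assms(3-5) by linarith+
  then show ?thesis
    using log_convex_shift[OF assms(1,2) \<open>m \<le> b\<close>, of "a - m"] \<open>M \<le> n\<close> by simp
qed

section \<open>Parity of distances in a tree\<close>

lemma regular_tree_reachable:
  assumes "regular_tree \<Delta> E"
  shows "(u, v) \<in> E ^^ gdist E u v"
proof -
  have "\<exists>n. (u, v) \<in> E ^^ n"
    using assms rtrancl_imp_relpow[of "(u, v)" E] unfolding regular_tree_def by blast
  then show ?thesis
    unfolding gdist_def by (rule LeastI_ex)
qed

lemma gdist_le:
  assumes "(u, v) \<in> E ^^ n"
  shows "gdist E u v \<le> n"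
  unfolding gdist_def using assms by (rule Least_le)

lemma gdist_adjacent_le:
  assumes "regular_tree \<Delta> E" and "(u, v) \<in> E"
  shows "gdist E r v \<le> Suc (gdist E r u)"
  using relpow_Suc_I[OF regular_tree_reachable[OF assms(1)] assms(2)] by (rule gdist_le)

lemma gdist_parent:
  assumes tree: "regular_tree \<Delta> E" and "gdist E r v = Suc n"
  obtains u where "(u, v) \<in> E" and "gdist E r u = n"
proof -
  from regular_tree_reachable[OF tree, of r v] \<open>gdist E r v = Suc n\<close>
  obtain u where u: "(r, u) \<in> E ^^ n" "(u, v) \<in> E"
    by (metis relpow_Suc_E)
  have "gdist E r u = n"
    using gdist_le[OF u(1)] gdist_adjacent_le[OF tree u(2), of r] \<open>gdist E r v = Suc n\<close> by simp
  with u(2) show ?thesis using that by blast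
qed

text \<open>The path climbs from both nodes to parents until the two walks merge; its interior stays
  below level \<open>n\<close>, which is why prepending and appending the end nodes creates no repetition.
  Its purpose is the case of adjacent nodes of equal level, whose edge would close it to a cycle.\<close>

lemma path_through_lower_levels:
  assumes tree: "regular_tree \<Delta> E"
    and "gdist E r a = n" and "gdist E r b = n" and "a \<noteq> b"
  shows "\<exists>vs. length vs \<ge> 3 \<and> distinct vs \<and> successively (\<lambda>u v. (u, v) \<in> E) vs \<and>
    hd vs = a \<and> last vs = b \<and> (\<forall>v\<in>set vs. gdist E r v \<le> n)"
  using assms(2-)
proof (induction n arbitrary: a b)
  case 0
  then show ?case
    using regular_tree_reachable[OF tree, of r a] regular_tree_reachable[OF tree, of r b] by simp
next
  case (Suc n)
  obtain a' where a': "(a', a) \<in> E" "gdist E r a' = n"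
    using gdist_parent[OF tree Suc.prems(1)] .
  obtain b' where b': "(b', b) \<in> E" "gdist E r b' = n"
    using gdist_parent[OF tree Suc.prems(2)] .
  have "(a, a') \<in> E"
    using a' tree unfolding regular_tree_def by (meson symD)
  show ?case
  proof (cases "a' = b'")
    case True
    then show ?thesis
      using a' b' \<open>(a, a') \<in> E\<close> Suc.prems by (intro exI[of _ "[a, a', b]"]) auto
  next
    case False
    then obtain vs where vs: "length vs \<ge> 3" "distinct vs" "successively (\<lambda>u v. (u, v) \<in> E) vs"
      "hd vs = a'" "last vs = b'" "\<forall>v\<in>set vs. gdist E r v \<le> n"
      using Suc.IH[OF a'(2) b'(2)] by blast
    moreover have "vs \<noteq> []"
      using vs(1) by auto
    moreover have "a \<notin> set vs" "b \<notin> set vs"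
      using vs(6) Suc.prems by auto
    ultimately show ?thesis
      using \<open>(a, a') \<in> E\<close> b' Suc.prems
      by (intro exI[of _ "a # vs @ [b]"])
        (auto simp: successively_Cons successively_append_iff)
  qed
qed

lemma gdist_adjacent_neq:
  assumes tree: "regular_tree \<Delta> E" and "(u, v) \<in> E"
  shows "gdist E r u \<noteq> gdist E r v"
proof
  assume "gdist E r u = gdist E r v"
  moreover have "u \<noteq> v"
    using assms unfolding regular_tree_def irrefl_def by blast
  ultimately obtain vs where "length vs \<ge> 3" "distinct vs"
    "successively (\<lambda>u v. (u, v) \<in> E) vs" "hd vs = v" "last vs = u"
    using path_through_lower_levels[OF tree, of r v "gdist E r v" u] by auto
  then have "is_cycle E vs"
    using \<open>(u, v) \<in> E\<close> unfolding is_cycle_def by simp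
  then show False
    using tree unfolding regular_tree_def by blast
qed

lemma even_nodes_adjacent_iff:
  assumes tree: "regular_tree \<Delta> E" and "(u, v) \<in> E"
  shows "v \<in> even_nodes E r \<longleftrightarrow> u \<notin> even_nodes E r"
proof -
  have "(v, u) \<in> E"
    using assms unfolding regular_tree_def by (meson symD)
  then have "gdist E r v = Suc (gdist E r u) \<or> gdist E r u = Suc (gdist E r v)"
    using gdist_adjacent_le[OF tree, of u v r] gdist_adjacent_le[OF tree, of v u r]
      gdist_adjacent_neq[OF assms, of r] \<open>(u, v) \<in> E\<close> by linarith
  then show ?thesis
    unfolding even_nodes_def by auto
qed

section \<open>The local factors\<close>

definition spin_weight :: "real \<Rightarrow> (nat \<Rightarrow> real) \<Rightarrow> nat \<Rightarrow> nat \<Rightarrow> real" where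
  "spin_weight lam \<theta> s k = (if s = 0 then \<theta> k else if k = 0 then lam else 0)"

lemma spin_weight_nonneg:
  assumes "lam > 0" and "\<forall>k\<le>n. \<theta> k > 0" and "k \<le> n"
  shows "spin_weight lam \<theta> s k \<ge> 0"
  using assms by (auto simp: spin_weight_def less_imp_le)

lemma sum_spins_le_card:
  fixes x :: "'a \<Rightarrow> nat"
  assumes "\<forall>j\<in>A. x j \<in> {0, 1}"
  shows "sum x A \<le> card A"
  using sum_bounded_above[of A x 1] assms by force

text \<open>A node \<open>i\<close> with spins \<open>s\<close> and \<open>t\<close> in two configurations, and its neighbors \<open>A\<close> with spins
  \<open>x\<close> and \<open>y\<close>: the lattice operations act in opposite directions on the center and on \<open>A\<close>.\<close>

lemma spin_weight_supermodular:
  fixes x y :: "'a \<Rightarrow> nat"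
  assumes lam: "lam > 0" and pos: "\<forall>k\<le>n. \<theta> k > 0" and conv: "log_convex n \<theta>"
    and A: "finite A" "card A \<le> n"
    and x: "\<forall>j\<in>A. x j \<in> {0, 1}" and y: "\<forall>j\<in>A. y j \<in> {0, 1}"
    and s: "s \<in> {0, 1}" and t: "t \<in> {0, 1}"
  shows "spin_weight lam \<theta> s (sum x A) * spin_weight lam \<theta> t (sum y A)
    \<le> spin_weight lam \<theta> (min s t) (\<Sum>j\<in>A. max (x j) (y j)) *
      spin_weight lam \<theta> (max s t) (\<Sum>j\<in>A. min (x j) (y j))"
    (is "?L \<le> ?R")
proof -
  have max_le: "(\<Sum>j\<in>A. max (x j) (y j)) \<le> n"
    using sum_spins_le_card[of A "\<lambda>j. max (x j) (y j)"] x y A(2) by force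
  have min_le: "(\<Sum>j\<in>A. min (x j) (y j)) \<le> sum x A" "(\<Sum>j\<in>A. min (x j) (y j)) \<le> sum y A"
    by (auto intro: sum_mono)
  have min_max: "(\<Sum>j\<in>A. min (x j) (y j)) + (\<Sum>j\<in>A. max (x j) (y j)) = sum x A + sum y A"
    unfolding sum.distrib[symmetric] by (rule sum.cong) auto
  have "sum x A \<le> n" "sum y A \<le> n"
    using sum_spins_le_card[OF x] sum_spins_le_card[OF y] A(2) by auto
  have R_nonneg: "?R \<ge> 0"
    using max_le min_le(1) \<open>sum x A \<le> n\<close>
    by (intro mult_nonneg_nonneg spin_weight_nonneg[OF lam pos]) auto
  show ?thesis
  proof (cases "s = 0 \<and> t = 0")
    case True
    then show ?thesis
      using log_convex_spread[OF conv pos min_le min_max max_le]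
      by (simp add: spin_weight_def mult.commute)
  next
    case False
    show ?thesis
    proof (cases "(s = 1 \<and> sum x A \<noteq> 0) \<or> (t = 1 \<and> sum y A \<noteq> 0)")
      case True
      then have "?L = 0"
        by (auto simp: spin_weight_def)
      then show ?thesis
        using R_nonneg by linarith
    next
      \<comment> \<open>The minimum with an empty neighborhood is empty and the maximum is the other
        neighborhood, so the right-hand side pairs spin \<open>1\<close> with the empty neighborhood, as the
        left-hand side does.\<close>
      case False
      then have "(s = 1 \<longrightarrow> (\<forall>j\<in>A. x j = 0)) \<and> (t = 1 \<longrightarrow> (\<forall>j\<in>A. y j = 0))"
        using A(1) by auto
      with \<open>\<not> (s = 0 \<and> t = 0)\<close> show ?thesis
        using s t by (auto simp: spin_weight_def mult.commute)
    qed
  qed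
qed

section \<open>The Gibbs weight as a product\<close>

text \<open>On an infinite index set the empty-sum and empty-product conventions agree, both sides
  being \<open>1\<close>.\<close>

lemma exp_ereal_minus_sum:
  assumes "\<And>i. i \<in> A \<Longrightarrow> f i \<noteq> - \<infinity>"
  shows "exp_ereal (- sum f A) = (\<Prod>i\<in>A. exp_ereal (- f i))"
  using assms
proof (induction A rule: infinite_finite_induct)
  case (insert i A)
  have "sum f A \<noteq> - \<infinity>"
    using \<open>finite A\<close> insert.prems by (induction A rule: finite_induct) auto
  then have "exp_ereal (- (f i + sum f A)) = exp_ereal (- f i) * exp_ereal (- sum f A)"
    using insert.prems[of i]
    by (cases "f i"; cases "sum f A") (auto simp: exp_ereal_def exp_add[symmetric])
  then show ?case
    using insert by simp
qed (auto simp: exp_ereal_def zero_ereal_def)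

lemma exp_ereal_minus_potential:
  assumes tree: "regular_tree \<Delta> E" and lam: "lam > 0" and pos: "\<forall>k\<le>\<Delta>. \<theta> k > 0"
    and \<omega>: "\<forall>j\<in>nbhd E i. \<omega> j \<in> {0, 1}"
  shows "exp_ereal (- potential E lam \<theta> i (restrict \<omega> (nbhd E i)))
    = spin_weight lam \<theta> (\<omega> i) (sum \<omega> (E `` {i}))"
proof -
  have fin: "finite (E `` {i})" and card: "card (E `` {i}) = \<Delta>" and "i \<notin> E `` {i}"
    using tree unfolding regular_tree_def irrefl_def by blast+
  have sum_nbhd: "(\<Sum>j\<in>nbhd E i. restrict \<omega> (nbhd E i) j) = \<omega> i + sum \<omega> (E `` {i})"
    using fin \<open>i \<notin> E `` {i}\<close> by (simp add: nbhd_def)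
  have "sum \<omega> (E `` {i}) \<le> \<Delta>"
    using sum_spins_le_card[of "E `` {i}" \<omega>] \<omega> card by (simp add: nbhd_def)
  then have "\<theta> (sum \<omega> (E `` {i})) > 0"
    using pos by blast
  moreover have "restrict \<omega> (nbhd E i) i = \<omega> i" "\<omega> i \<in> {0, 1}"
    using \<omega> by (auto simp: nbhd_def)
  ultimately show ?thesis
    using lam unfolding potential_def sum_nbhd spin_weight_def
    by (auto simp: exp_ereal_def Let_def)
qed

text \<open>A neighborhood that meets \<open>S\<close> has all its nodes within distance \<open>2\<close> of \<open>S\<close>; hence every factor
  of the weight is determined by the spins on \<open>S\<close> and its boundary.\<close>

lemma nbhd_subset_boundary:
  assumes tree: "regular_tree \<Delta> E" and "nbhd E i \<inter> S \<noteq> {}"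
  shows "nbhd E i \<subseteq> S \<union> boundary E S"
proof
  fix v assume v: "v \<in> nbhd E i"
  obtain u where u: "u \<in> S" "u \<in> nbhd E i"
    using assms(2) by blast
  have "sym E"
    using tree unfolding regular_tree_def by blast
  have near: "gdist E u v \<le> 2" if "(u, v) \<in> E ^^ n" "n \<le> 2" for n
    using gdist_le[OF that(1)] that(2) by simp
  consider "u = v" | "(u, v) \<in> E" | "(u, i) \<in> E" "(i, v) \<in> E"
    using u(2) v \<open>sym E\<close> unfolding nbhd_def by (auto dest: symD)
  then have "gdist E u v \<le> 2"
  proof cases
    case 1
    then show ?thesis using near[of 0] by simp
  next
    case 2
    then show ?thesis using near[of 1] by simp
  next
    case 3
    then show ?thesis using near[of 2] by (auto simp: numeral_2_eq_2)
  qed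
  then show "v \<in> S \<union> boundary E S"
    using u(1) unfolding boundary_def by blast
qed

lemma combine_spin:
  assumes "\<omega> \<in> configs S" and "\<eta> \<in> configs S'" and "j \<in> S \<union> S'"
  shows "combine S S' \<omega> \<eta> j \<in> {0, 1}"
  using assms unfolding configs_def combine_def by (auto simp: PiE_iff)

lemma gibbs_weight_eq_prod:
  fixes E r d \<omega> \<eta>
  defines "T \<equiv> tree_ball E r d"
  defines "\<xi> \<equiv> combine T (boundary E T) \<omega> \<eta>"
  assumes tree: "regular_tree \<Delta> E" and lam: "lam > 0" and pos: "\<forall>k\<le>\<Delta>. \<theta> k > 0"
    and \<omega>: "\<omega> \<in> configs T" and \<eta>: "\<eta> \<in> configs (boundary E T)"
  shows "gibbs_weight E r lam \<theta> d \<eta> \<omega>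
    = (\<Prod>i | nbhd E i \<inter> T \<noteq> {}. spin_weight lam \<theta> (\<xi> i) (sum \<xi> (E `` {i})))"
proof -
  have "gibbs_weight E r lam \<theta> d \<eta> \<omega>
    = exp_ereal (- (\<Sum>i | nbhd E i \<inter> T \<noteq> {}. potential E lam \<theta> i (restrict \<xi> (nbhd E i))))"
    by (simp add: gibbs_weight_def hamiltonian_def Let_def T_def \<xi>_def)
  also have "\<dots> = (\<Prod>i | nbhd E i \<inter> T \<noteq> {}.
      exp_ereal (- potential E lam \<theta> i (restrict \<xi> (nbhd E i))))"
    by (rule exp_ereal_minus_sum) (simp add: potential_def Let_def)
  also have "\<dots> = (\<Prod>i | nbhd E i \<inter> T \<noteq> {}. spin_weight lam \<theta> (\<xi> i) (sum \<xi> (E `` {i})))"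
  proof (rule prod.cong[OF refl])
    fix i assume "i \<in> {i. nbhd E i \<inter> T \<noteq> {}}"
    then have "nbhd E i \<subseteq> T \<union> boundary E T"
      using nbhd_subset_boundary[OF tree] by blast
    then have "\<forall>j\<in>nbhd E i. \<xi> j \<in> {0, 1}"
      unfolding \<xi>_def using combine_spin[OF \<omega> \<eta>] by blast
    then show "exp_ereal (- potential E lam \<theta> i (restrict \<xi> (nbhd E i)))
      = spin_weight lam \<theta> (\<xi> i) (sum \<xi> (E `` {i}))"
      by (rule exp_ereal_minus_potential[OF tree lam pos])
  qed
  finally show ?thesis .
qed

section \<open>The FKG inequality\<close>

text \<open>Both configurations carry the same spins \<open>\<eta>\<close> outside \<open>S\<close>, where minimum and maximum of a
  spin with itself change nothing; so meet and join may be taken on the extended configurations.\<close>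

lemma combine_meet_join:
  assumes "j \<in> S \<union> S'"
  shows "combine S S' (config_meet E r S \<omega>1 \<omega>2) \<eta> j =
      (if j \<in> even_nodes E r then min (combine S S' \<omega>1 \<eta> j) (combine S S' \<omega>2 \<eta> j)
       else max (combine S S' \<omega>1 \<eta> j) (combine S S' \<omega>2 \<eta> j))"
    and "combine S S' (config_join E r S \<omega>1 \<omega>2) \<eta> j =
      (if j \<in> even_nodes E r then max (combine S S' \<omega>1 \<eta> j) (combine S S' \<omega>2 \<eta> j)
       else min (combine S S' \<omega>1 \<eta> j) (combine S S' \<omega>2 \<eta> j))"
  using assms by (auto simp: combine_def config_meet_def config_join_def)

lemma gibbs_weight_nonneg: "gibbs_weight E r lam \<theta> d \<eta> \<omega> \<ge> 0"
  by (simp add: gibbs_weight_def exp_ereal_def Let_def)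

lemma gibbs_weight_supermodular:
  fixes E r d
  defines "T \<equiv> tree_ball E r d"
  assumes tree: "regular_tree \<Delta> E" and lam: "lam > 0" and pos: "\<forall>k\<le>\<Delta>. \<theta> k > 0"
    and conv: "log_convex \<Delta> \<theta>"
    and \<omega>1: "\<omega>1 \<in> configs T" and \<omega>2: "\<omega>2 \<in> configs T" and \<eta>: "\<eta> \<in> configs (boundary E T)"
  shows "gibbs_weight E r lam \<theta> d \<eta> \<omega>1 * gibbs_weight E r lam \<theta> d \<eta> \<omega>2
    \<le> gibbs_weight E r lam \<theta> d \<eta> (config_meet E r T \<omega>1 \<omega>2) *
      gibbs_weight E r lam \<theta> d \<eta> (config_join E r T \<omega>1 \<omega>2)"
proof -
  define ext where "ext \<omega> = combine T (boundary E T) \<omega> \<eta>" for \<omega>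
  define w where "w \<omega> i = spin_weight lam \<theta> (ext \<omega> i) (sum (ext \<omega>) (E `` {i}))" for \<omega> i
  define meet where "meet = config_meet E r T \<omega>1 \<omega>2"
  define join where "join = config_join E r T \<omega>1 \<omega>2"
  have weight: "gibbs_weight E r lam \<theta> d \<eta> \<omega> = (\<Prod>i | nbhd E i \<inter> T \<noteq> {}. w \<omega> i)"
    if "\<omega> \<in> configs T" for \<omega>
    unfolding w_def ext_def T_def
    using gibbs_weight_eq_prod[OF tree lam pos] that \<eta> unfolding T_def by blast
  have local: "0 \<le> w \<omega>1 i * w \<omega>2 i \<and> w \<omega>1 i * w \<omega>2 i \<le> w meet i * w join i"
    if i: "nbhd E i \<inter> T \<noteq> {}" for i
  proof -
    have fin: "finite (E `` {i})" and card: "card (E `` {i}) = \<Delta>"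
      using tree unfolding regular_tree_def by blast+
    have "nbhd E i \<subseteq> T \<union> boundary E T"
      by (rule nbhd_subset_boundary[OF tree i])
    then have inT: "i \<in> T \<union> boundary E T" "\<And>j. j \<in> E `` {i} \<Longrightarrow> j \<in> T \<union> boundary E T"
      unfolding nbhd_def by auto
    have spin: "ext \<omega> i \<in> {0, 1}" "\<forall>j\<in>E `` {i}. ext \<omega> j \<in> {0, 1}" if "\<omega> \<in> configs T" for \<omega>
      unfolding ext_def using combine_spin[OF that \<eta>] inT by blast+
    have "w \<omega> i \<ge> 0" if "\<omega> \<in> configs T" for \<omega>
      unfolding w_def using sum_spins_le_card[OF spin(2)[OF that]] card
      by (intro spin_weight_nonneg[OF lam pos]) simp
    then have nonneg: "0 \<le> w \<omega>1 i * w \<omega>2 i"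
      using \<omega>1 \<omega>2 by simp
    have opposite: "j \<in> even_nodes E r \<longleftrightarrow> i \<notin> even_nodes E r" if "j \<in> E `` {i}" for j
      using even_nodes_adjacent_iff[OF tree, of i j] that by blast
    note at_i = combine_meet_join[OF inT(1), of E r \<omega>1 \<omega>2 \<eta>, folded ext_def meet_def join_def]
    note at_nb = combine_meet_join[OF inT(2), of _ E r \<omega>1 \<omega>2 \<eta>, folded ext_def meet_def join_def]
    have supermod: "w \<omega>1 i * w \<omega>2 i
      \<le> spin_weight lam \<theta> (min (ext \<omega>1 i) (ext \<omega>2 i)) (\<Sum>j\<in>E `` {i}. max (ext \<omega>1 j) (ext \<omega>2 j)) *
        spin_weight lam \<theta> (max (ext \<omega>1 i) (ext \<omega>2 i)) (\<Sum>j\<in>E `` {i}. min (ext \<omega>1 j) (ext \<omega>2 j))"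
      (is "_ \<le> ?lower * ?upper")
      unfolding w_def
      using spin_weight_supermodular[OF lam pos conv fin] card spin \<omega>1 \<omega>2 by simp
    have sums:
      "sum (ext meet) (E `` {i}) = (\<Sum>j\<in>E `` {i}. if i \<in> even_nodes E r
        then max (ext \<omega>1 j) (ext \<omega>2 j) else min (ext \<omega>1 j) (ext \<omega>2 j))"
      "sum (ext join) (E `` {i}) = (\<Sum>j\<in>E `` {i}. if i \<in> even_nodes E r
        then min (ext \<omega>1 j) (ext \<omega>2 j) else max (ext \<omega>1 j) (ext \<omega>2 j))"
      using at_nb opposite by (auto intro!: sum.cong)
    show ?thesis
    proof (cases "i \<in> even_nodes E r")
      case True
      then have "w meet i = ?lower" "w join i = ?upper"
        unfolding w_def by (simp_all add: at_i sums)
      then show ?thesis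
        using supermod nonneg by simp
    next
      case False
      then have "w meet i = ?upper" "w join i = ?lower"
        unfolding w_def by (simp_all add: at_i sums)
      then show ?thesis
        using supermod nonneg by (simp add: mult.commute)
    qed
  qed
  have "(\<Prod>i | nbhd E i \<inter> T \<noteq> {}. w \<omega>1 i * w \<omega>2 i)
      \<le> (\<Prod>i | nbhd E i \<inter> T \<noteq> {}. w meet i * w join i)"
    using local by (intro prod_mono) auto
  moreover have "meet \<in> configs T" "join \<in> configs T"
    unfolding meet_def join_def
    using \<omega>1 \<omega>2 by (auto intro: config_meet_in_configs config_join_in_configs)
  ultimately show ?thesis
    using weight \<omega>1 \<omega>2 unfolding meet_def[symmetric] join_def[symmetric]
    by (simp add: prod.distrib)
qed

theorem theorem3:
  fixes \<Delta> :: nat and E :: "('v \<times> 'v) set" and r :: 'v and \<theta> :: "nat \<Rightarrow> real"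
  assumes "\<Delta> \<ge> 3"
    and "regular_tree \<Delta> E"
    and "\<forall>k\<le>\<Delta>. \<theta> k > 0"
    and "log_convex \<Delta> \<theta>"
  shows "\<forall>lam>0. satisfies_FKG E r lam \<theta>"
proof (intro allI impI)
  fix lam :: real assume lam: "lam > 0"
  show "satisfies_FKG E r lam \<theta>"
    unfolding satisfies_FKG_def
  proof (intro allI ballI)
    fix d \<omega>1 \<omega>2 \<eta>
    let ?T = "tree_ball E r d"
    let ?Z = "\<Sum>\<nu>\<in>configs ?T. gibbs_weight E r lam \<theta> d \<eta> \<nu>"
    assume \<omega>: "\<omega>1 \<in> configs ?T" "\<omega>2 \<in> configs ?T"
      and "\<eta> \<in> hardcore_configs E (boundary E ?T)"
    then have "\<eta> \<in> configs (boundary E ?T)"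
      unfolding hardcore_configs_def by blast
    note supermod = gibbs_weight_supermodular[OF assms(2) lam assms(3,4) \<omega> this]
    have "?Z * ?Z \<ge> 0"
      by simp
    from divide_right_mono[OF supermod this]
    show "gibbs_prob E r lam \<theta> d \<eta> (config_meet E r ?T \<omega>1 \<omega>2) *
        gibbs_prob E r lam \<theta> d \<eta> (config_join E r ?T \<omega>1 \<omega>2)
        \<ge> gibbs_prob E r lam \<theta> d \<eta> \<omega>1 * gibbs_prob E r lam \<theta> d \<eta> \<omega>2"
      unfolding gibbs_prob_def by simp
  qed
qed

end
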